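(* The Kakutani-Fibonacci transformation $T:[0,1[\to[0,1[$ is ergodic (with respect to Lebesgue measure on $[0,1[$).
   Context: $[a,b[$ denotes the half-open interval $\{x:a\le x<b\}$. Let $\alpha=\frac{\sqrt5-1}{2}$, so $\alpha+\alpha^2=1$. The Kakutani-Fibonacci transformation $T:[0,1[\to[0,1[$ is defined piecewise by: $T(x)=x+\alpha$ for $x\in I_1=[0,\alpha^2[$; and, for every $k\ge1$, $T(x)=x+\alpha^{2k}-\sum_{j=0}^{k-1}\alpha^{2j+1}$ for $x\in I_{2k}=\big[\sum_{j=0}^{k-1}\alpha^{2j+1},\sum_{j=0}^{k}\alpha^{2j+1}\big[$, and $T(x)=x+\alpha^{2k+1}-\sum_{j=0}^{k-1}\alpha^{2(j+1)}$ for $x\in I_{2k+1}=\big[\sum_{j=0}^{k-1}\alpha^{2(j+1)},\sum_{j=0}^{k}\alpha^{2(j+1)}\big[$. The intervals $I_k$, $k\ge1$, partition $[0,1[$. A measure-preserving map $T$ of a probability space is ergodic if every measurable $A$ with $T^{-1}(A)=A$ has measure $0$ or $1$. *)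

theory Defs
  imports "HOL-Probability.Probability"
begin

definition measure_preserving_map :: "'a measure \<Rightarrow> ('a \<Rightarrow> 'a) \<Rightarrow> bool" where
  "measure_preserving_map M T \<longleftrightarrow>
     T \<in> measurable M M \<and>
     (\<forall>A\<in>sets M. emeasure M (T -` A \<inter> space M) = emeasure M A)"

definition ergodic_map :: "'a measure \<Rightarrow> ('a \<Rightarrow> 'a) \<Rightarrow> bool" where
  "ergodic_map M T \<longleftrightarrow>
     prob_space M \<and> measure_preserving_map M T \<and>
     (\<forall>A\<in>sets M. T -` A \<inter> space M = A \<longrightarrow> measure M A = 0 \<or> measure M A = 1)"

definition kf_alpha :: real where
  "kf_alpha = (sqrt 5 - 1) / 2"

(* kf_interval n is I_n and kf_shift n is the constant T x - x on I_n; both are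
   meaningful only for n >= 1. *)

definition kf_interval :: "nat \<Rightarrow> real set" where
  "kf_interval n =
     (if n = 1 then {0..<kf_alpha ^ 2}
      else let k = n div 2 in
        if even n
        then {(\<Sum>j<k. kf_alpha ^ (2 * j + 1))..<(\<Sum>j\<le>k. kf_alpha ^ (2 * j + 1))}
        else {(\<Sum>j<k. kf_alpha ^ (2 * (j + 1)))..<(\<Sum>j\<le>k. kf_alpha ^ (2 * (j + 1)))})"

definition kf_shift :: "nat \<Rightarrow> real" where
  "kf_shift n =
     (if n = 1 then kf_alpha
      else let k = n div 2 in
        if even n
        then kf_alpha ^ (2 * k) - (\<Sum>j<k. kf_alpha ^ (2 * j + 1))
        else kf_alpha ^ (2 * k + 1) - (\<Sum>j<k. kf_alpha ^ (2 * (j + 1))))"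

(* Outside [0,1[ no index n exists, and the value is irrelevant. *)

definition kakutani_fibonacci :: "real \<Rightarrow> real" where
  "kakutani_fibonacci x = x + kf_shift (THE n. 1 \<le> n \<and> x \<in> kf_interval n)"

lemma kf_alpha_pos: "0 < kf_alpha" and kf_alpha_less_1: "kf_alpha < 1"
proof -
  have "1 < sqrt 5" "sqrt 5 < 3"
    by (simp_all add: real_less_lsqrt)
  then show "0 < kf_alpha" "kf_alpha < 1"
    by (simp_all add: kf_alpha_def)
qed

lemma kf_alpha_eq: "kf_alpha + kf_alpha ^ 2 = 1"
  by (simp add: kf_alpha_def power2_eq_square field_simps)

lemma kf_alpha_power_add: "kf_alpha ^ Suc n + kf_alpha ^ Suc (Suc n) = kf_alpha ^ n"
proof -
  have "kf_alpha ^ Suc n + kf_alpha ^ Suc (Suc n) = kf_alpha ^ n * (kf_alpha + kf_alpha ^ 2)"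
    by (simp add: algebra_simps power2_eq_square)
  then show ?thesis by (simp add: kf_alpha_eq)
qed

lemma kf_sum_odd: "(\<Sum>j<k. kf_alpha ^ (2 * j + 1)) = 1 - kf_alpha ^ (2 * k)"
proof (induction k)
  case (Suc k)
  then show ?case using kf_alpha_power_add[of "2 * k"] by simp
qed simp

lemma kf_sum_even: "(\<Sum>j<k. kf_alpha ^ (2 * (j + 1))) = kf_alpha - kf_alpha ^ (2 * k + 1)"
proof (induction k)
  case (Suc k)
  then show ?case using kf_alpha_power_add[of "2 * k + 1"] by simp
qed simp

lemma kf_interval_1: "kf_interval 1 = {0..<kf_alpha ^ 2}"
  by (simp add: kf_interval_def)

lemma kf_interval_even:
  assumes "1 \<le> k"
  shows "kf_interval (2 * k) = {1 - kf_alpha ^ (2 * k)..<1 - kf_alpha ^ (2 * Suc k)}"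
  using assms kf_sum_odd[of k] kf_sum_odd[of "Suc k"]
  by (simp add: kf_interval_def lessThan_Suc_atMost)

lemma kf_interval_odd:
  "kf_interval (2 * k + 1) = {kf_alpha - kf_alpha ^ (2 * k + 1)..<kf_alpha - kf_alpha ^ (2 * Suc k + 1)}"
proof (cases "k = 0")
  case True
  have "kf_alpha ^ 2 = kf_alpha - kf_alpha ^ 3"
    using kf_alpha_power_add[of 1] by (simp add: numeral_2_eq_2 numeral_3_eq_3)
  with True show ?thesis
    by (simp add: kf_interval_def)
next
  case False
  then show ?thesis
    using kf_sum_even[of k] kf_sum_even[of "Suc k"]
    by (simp add: kf_interval_def lessThan_Suc_atMost)
qed

lemma kf_alpha_power_bracket:
  assumes "0 < y" "y \<le> kf_alpha ^ m"
  shows "\<exists>!k. kf_alpha ^ (2 * Suc k + m) < y \<and> y \<le> kf_alpha ^ (2 * k + m)"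
proof -
  have anti: "kf_alpha ^ b \<le> kf_alpha ^ a" if "a \<le> b" for a b
    using that kf_alpha_pos kf_alpha_less_1 by (simp add: power_decreasing)
  obtain N where N: "kf_alpha ^ N < y"
    using real_arch_pow_inv[OF assms(1) kf_alpha_less_1] by blast
  define k where "k = (LEAST k. kf_alpha ^ (2 * Suc k + m) < y)"
  have "kf_alpha ^ (2 * Suc N + m) < y"
    using N anti[of N "2 * Suc N + m"] by simp
  then have k: "kf_alpha ^ (2 * Suc k + m) < y"
    unfolding k_def by (rule LeastI)
  have k': "y \<le> kf_alpha ^ (2 * k + m)"
  proof (cases k)
    case 0
    then show ?thesis using assms by simp
  next
    case (Suc i)
    then have "\<not> kf_alpha ^ (2 * Suc i + m) < y"
      using not_less_Least[of i "\<lambda>k. kf_alpha ^ (2 * Suc k + m) < y"] by (simp add: k_def)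
    then show ?thesis by (simp add: Suc)
  qed
  show ?thesis
  proof (rule ex1I[of _ k])
    fix i assume i: "kf_alpha ^ (2 * Suc i + m) < y \<and> y \<le> kf_alpha ^ (2 * i + m)"
    show "i = k"
    proof (rule linorder_cases[of i k])
      assume "i < k"
      then have "kf_alpha ^ (2 * k + m) \<le> kf_alpha ^ (2 * Suc i + m)" by (intro anti) simp
      then show ?thesis using i k' by linarith
    next
      assume "k < i"
      then have "kf_alpha ^ (2 * i + m) \<le> kf_alpha ^ (2 * Suc k + m)" by (intro anti) simp
      then show ?thesis using i k by linarith
    qed
  qed (use k k' in blast)
qed

lemma kf_interval_even_subset: "1 \<le> k \<Longrightarrow> kf_interval (2 * k) \<subseteq> {kf_alpha..<1}"
proof -
  assume k: "1 \<le> k"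
  then have "kf_alpha ^ (2 * k) \<le> kf_alpha ^ 2"
    using kf_alpha_pos kf_alpha_less_1 by (intro power_decreasing) auto
  moreover have "0 < kf_alpha ^ (2 * Suc k)"
    using kf_alpha_pos by (rule zero_less_power)
  ultimately show ?thesis
    using kf_alpha_eq kf_interval_even[OF k] by auto
qed

lemma kf_interval_odd_subset: "kf_interval (2 * k + 1) \<subseteq> {0..<kf_alpha}"
proof -
  have "kf_alpha ^ (2 * k + 1) \<le> kf_alpha ^ 1"
    using kf_alpha_pos kf_alpha_less_1 by (intro power_decreasing) auto
  moreover have "0 < kf_alpha ^ (2 * Suc k + 1)"
    using kf_alpha_pos by (rule zero_less_power)
  ultimately show ?thesis
    using kf_interval_odd[of k] by auto
qed

lemma kf_interval_ex1:
  assumes "x \<in> {0..<1}"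
  shows "\<exists>!n. 1 \<le> n \<and> x \<in> kf_interval n"
proof (cases "x < kf_alpha")
  case True
  have iff: "x \<in> kf_interval (2 * k + 1) \<longleftrightarrow>
      kf_alpha ^ (2 * Suc k + 1) < kf_alpha - x \<and> kf_alpha - x \<le> kf_alpha ^ (2 * k + 1)" for k
    unfolding kf_interval_odd atLeastLessThan_iff by (intro iffI conjI) linarith+
  obtain k where k: "x \<in> kf_interval (2 * k + 1)"
    and u: "\<And>i. x \<in> kf_interval (2 * i + 1) \<Longrightarrow> i = k"
    using kf_alpha_power_bracket[of "kf_alpha - x" 1] True assms
    unfolding iff by auto
  show ?thesis
  proof (rule ex1I[of _ "2 * k + 1"])
    fix n assume n: "1 \<le> n \<and> x \<in> kf_interval n"
    show "n = 2 * k + 1"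
    proof (cases "even n")
      case True
      then obtain i where "n = 2 * i" by blast
      with n kf_interval_even_subset[of i] \<open>x < kf_alpha\<close> show ?thesis by auto
    next
      case False
      then obtain i where i: "n = 2 * i + 1" by (elim oddE)
      with n u[of i] show ?thesis by simp
    qed
  qed (use k in simp)
next
  case False
  have iff: "x \<in> kf_interval (2 * Suc k) \<longleftrightarrow>
      kf_alpha ^ (2 * Suc k + 2) < 1 - x \<and> 1 - x \<le> kf_alpha ^ (2 * k + 2)" for k
    using kf_interval_even[of "Suc k"] by auto
  obtain k where k: "x \<in> kf_interval (2 * Suc k)"
    and u: "\<And>i. x \<in> kf_interval (2 * Suc i) \<Longrightarrow> i = k"
    using kf_alpha_power_bracket[of "1 - x" 2] False assms kf_alpha_eq
    unfolding iff by auto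
  show ?thesis
  proof (rule ex1I[of _ "2 * Suc k"])
    fix n assume n: "1 \<le> n \<and> x \<in> kf_interval n"
    show "n = 2 * Suc k"
    proof (cases "even n")
      case True
      then obtain i where i: "n = 2 * i" by blast
      with n obtain i' where "i = Suc i'" by (cases i) auto
      with n i u[of i'] show ?thesis by simp
    next
      case odd: False
      then obtain i where "n = 2 * i + 1" by (elim oddE)
      with n kf_interval_odd_subset[of i] False show ?thesis by auto
    qed
  qed (use k in simp)
qed

lemma kf_interval_subset: "1 \<le> n \<Longrightarrow> kf_interval n \<subseteq> {0..<1}"
proof (cases "even n")
  case True
  assume "1 \<le> n"
  with True obtain i where "n = 2 * i" "1 \<le> i" by auto
  then show ?thesis using kf_interval_even_subset[of i] kf_alpha_pos by force
next
  case False
  then obtain i where "n = 2 * i + 1" by (elim oddE)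
  then show ?thesis using kf_interval_odd_subset[of i] kf_alpha_less_1 by force
qed

lemma kf_interval_partition:
  "(\<Union>n\<in>{1..}. kf_interval n) = {0..<1}" "disjoint_family_on kf_interval {1..}"
proof -
  show "(\<Union>n\<in>{1..}. kf_interval n) = {0..<1}"
  proof (intro equalityI subsetI)
    fix x assume "x \<in> (\<Union>n\<in>{1..}. kf_interval n)"
    then obtain n where "1 \<le> n" "x \<in> kf_interval n" by auto
    then show "x \<in> {0..<1}" using kf_interval_subset by blast
  next
    fix x :: real assume "x \<in> {0..<1}"
    from ex1_implies_ex[OF kf_interval_ex1[OF this]]
    obtain n where "1 \<le> n" "x \<in> kf_interval n" by blast
    then show "x \<in> (\<Union>n\<in>{1..}. kf_interval n)" by auto
  qed
  show "disjoint_family_on kf_interval {1..}"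
    unfolding disjoint_family_on_def
  proof (intro ballI impI equals0I)
    fix m n x assume *: "m \<in> {1..}" "n \<in> {1..}" "m \<noteq> n" "x \<in> kf_interval m \<inter> kf_interval n"
    then have "x \<in> {0..<1}" using kf_interval_subset[of m] by auto
    from kf_interval_ex1[OF this] * show False by auto
  qed
qed

lemma kakutani_fibonacci_on_interval:
  assumes "1 \<le> n" "x \<in> kf_interval n"
  shows "kakutani_fibonacci x = x + kf_shift n"
proof -
  have "x \<in> {0..<1}" using assms kf_interval_subset by blast
  from the1_equality[OF kf_interval_ex1[OF this]] assms show ?thesis
    by (simp add: kakutani_fibonacci_def)
qed

lemma kakutani_fibonacci_1:
  "x \<in> {0..<kf_alpha ^ 2} \<Longrightarrow> kakutani_fibonacci x = x + kf_alpha"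
  using kakutani_fibonacci_on_interval[of 1 x] kf_interval_1 by (simp add: kf_shift_def)

lemma kakutani_fibonacci_even:
  assumes "1 \<le> k"
    and "x \<in> {(\<Sum>j=0..k-1. kf_alpha ^ (2 * j + 1))..<(\<Sum>j=0..k. kf_alpha ^ (2 * j + 1))}"
  shows "kakutani_fibonacci x = x + kf_alpha ^ (2 * k) - (\<Sum>j=0..k-1. kf_alpha ^ (2 * j + 1))"
proof -
  have "{0..k-1} = {..<k}" "{0..k} = {..k}" using assms(1) by auto
  with assms kakutani_fibonacci_on_interval[of "2 * k" x] show ?thesis
    by (simp add: kf_interval_def kf_shift_def)
qed

lemma kakutani_fibonacci_odd:
  assumes "1 \<le> k"
    and "x \<in> {(\<Sum>j=0..k-1. kf_alpha ^ (2 * (j + 1)))..<(\<Sum>j=0..k. kf_alpha ^ (2 * (j + 1)))}"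
  shows "kakutani_fibonacci x = x + kf_alpha ^ (2 * k + 1) - (\<Sum>j=0..k-1. kf_alpha ^ (2 * (j + 1)))"
proof -
  have "{0..k-1} = {..<k}" "{0..k} = {..k}" using assms(1) by auto
  with assms kakutani_fibonacci_on_interval[of "2 * k + 1" x] show ?thesis
    by (simp add: kf_interval_def kf_shift_def)
qed

lemma kakutani_fibonacci_range:
  assumes "x \<in> {0..<1}"
  shows "kakutani_fibonacci x \<in> {0..<1}"
proof -
  obtain n where n: "1 \<le> n" "x \<in> kf_interval n"
    using ex1_implies_ex[OF kf_interval_ex1[OF assms]] by blast
  have T: "kakutani_fibonacci x = x + kf_shift n"
    using n by (rule kakutani_fibonacci_on_interval)
  have pos: "0 < kf_alpha ^ n" using kf_alpha_pos by (rule zero_less_power)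
  have le: "kf_alpha ^ (n - 1) \<le> 1"
    using kf_alpha_pos kf_alpha_less_1 by (intro power_le_one) auto
  have sum: "kf_alpha ^ n + kf_alpha ^ (n + 1) = kf_alpha ^ (n - 1)"
    using kf_alpha_power_add[of "n - 1"] n(1) by simp
  have "kf_alpha ^ n \<le> x + kf_shift n \<and> x + kf_shift n < kf_alpha ^ n + kf_alpha ^ (n + 1)"
  proof (cases "even n")
    case True
    then obtain k where k: "n = 2 * k" by blast
    with n have k1: "1 \<le> k" by simp
    have "kf_shift n = kf_alpha ^ n - (1 - kf_alpha ^ n)"
      using k k1 kf_sum_odd[of k] by (simp add: kf_shift_def)
    moreover have "1 - kf_alpha ^ n \<le> x" "x < 1 - kf_alpha ^ (n + 2)"
      using n(2) k kf_interval_even[OF k1] by auto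
    moreover have "kf_alpha ^ (n + 1) + kf_alpha ^ (n + 2) = kf_alpha ^ n"
      using kf_alpha_power_add[of n] by simp
    ultimately show ?thesis by linarith
  next
    case False
    then obtain k where k: "n = 2 * k + 1" by (elim oddE)
    have "kf_shift n = kf_alpha ^ n - (kf_alpha - kf_alpha ^ n)"
      using k kf_sum_even[of k] by (cases "k = 0") (simp_all add: kf_shift_def)
    moreover have "kf_alpha - kf_alpha ^ n \<le> x" "x < kf_alpha - kf_alpha ^ (n + 2)"
      using n(2) k kf_interval_odd[of k] by auto
    moreover have "kf_alpha ^ (n + 1) + kf_alpha ^ (n + 2) = kf_alpha ^ n"
      using kf_alpha_power_add[of n] by simp
    ultimately show ?thesis by linarith
  qed
  with T pos le sum show ?thesis by simp
qed

end

theory Submission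
  imports Defs
begin

text \<open>\<open>T\<close> translates \<open>I_n\<close> onto \<open>[\<alpha>^n, \<alpha>^(n-1)[\<close>, so it preserves Lebesgue measure.
  Splitting \<open>[0,1[\<close> repeatedly in the ratio \<open>\<alpha> : \<alpha>^2\<close> yields intervals \<open>[u, u + \<alpha>^n[\<close>, each
  of which is a translate of \<open>[0, \<alpha>^n[\<close> by an iterate of \<open>T\<close>. For an invariant set \<open>A\<close>,
  the numbers \<open>m_n = \<mu>(A \<inter> [0, \<alpha>^n[)\<close> therefore satisfy \<open>m_n = m_(n+1) + m_(n+2)\<close>, and since
  they are bounded, \<open>m_n = \<mu>(A) \<alpha>^n\<close>. Hence \<open>A\<close> has density \<open>\<mu>(A)\<close> in all these
  intervals and so in every measurable set; in \<open>A\<close> itself this gives \<open>\<mu>(A) = \<mu>(A)^2\<close>.\<close>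

section \<open>Closed forms for the intervals and shifts\<close>

lemma kf_alpha_power_pos: "0 < kf_alpha ^ n"
  using kf_alpha_pos by (rule zero_less_power)

lemma kf_alpha_power_antimono: "m \<le> n \<Longrightarrow> kf_alpha ^ n \<le> kf_alpha ^ m"
  using kf_alpha_pos kf_alpha_less_1 by (simp add: power_decreasing)

lemma kf_alpha_power_le_1: "kf_alpha ^ n \<le> 1"
  using kf_alpha_power_antimono[of 0 n] by simp

text \<open>The left endpoint of \<open>I_n\<close> for \<open>n \<ge> 1\<close>, with the sums
  evaluated so that both parities share one formula. The value at index 0 belongs to no interval;
  like the value at 1 it equals 0, which starts the two-step induction on iterates.\<close>

definition kf_start :: "nat \<Rightarrow> real" where
  "kf_start n = (if even n then 1 else kf_alpha) - kf_alpha ^ n"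

lemma kf_start_Suc_Suc: "kf_start (Suc (Suc n)) = kf_start n + kf_alpha ^ Suc n"
  using kf_alpha_power_add[of n] by (simp add: kf_start_def)

lemma kf_interval_conv_start:
  assumes "1 \<le> n"
  shows "kf_interval n = {kf_start n..<kf_start n + kf_alpha ^ Suc n}"
proof -
  have end_eq: "kf_start n + kf_alpha ^ Suc n = (if even n then 1 else kf_alpha) - kf_alpha ^ Suc (Suc n)"
    using kf_alpha_power_add[of n] by (simp add: kf_start_def)
  show ?thesis
  proof (cases "even n")
    case True
    then obtain k where k: "n = 2 * k" by blast
    then show ?thesis
      using assms kf_interval_even[of k] unfolding end_eq by (simp add: kf_start_def)
  next
    case False
    then obtain k where k: "n = 2 * k + 1" by (elim oddE)
    then show ?thesis
      using kf_interval_odd[of k] unfolding end_eq by (simp add: kf_start_def)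
  qed
qed

lemma kf_shift_conv_start:
  assumes "1 \<le> n"
  shows "kf_shift n = kf_alpha ^ n - kf_start n"
proof (cases "even n")
  case True
  then obtain k where k: "n = 2 * k" by blast
  then show ?thesis
    using assms kf_sum_odd[of k] by (simp add: kf_start_def kf_shift_def)
next
  case False
  then obtain k where k: "n = 2 * k + 1" by (elim oddE)
  then show ?thesis
    using kf_sum_even[of k] by (cases "k = 0") (simp_all add: kf_start_def kf_shift_def)
qed

lemma kakutani_fibonacci_on_start:
  assumes "1 \<le> n" "x \<in> {0..<kf_alpha ^ Suc n}"
  shows "kakutani_fibonacci (x + kf_start n) = x + kf_alpha ^ n"
proof -
  have "x + kf_start n \<in> kf_interval n"
    using assms by (auto simp: kf_interval_conv_start)
  from kakutani_fibonacci_on_interval[OF assms(1) this] show ?thesis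
    using assms(1) by (simp add: kf_shift_conv_start)
qed

section \<open>Preservation of Lebesgue measure\<close>

lemma emeasure_lebesgue_translation:
  fixes S :: "real set"
  shows "emeasure lebesgue ((+) a ` S) = emeasure lebesgue S"
  using emeasure_lebesgue_affine[of 1 a S] by (simp add: ac_simps cong: image_cong_simp)

text \<open>On \<open>I_(n+1)\<close> the map is a translation onto
  \<open>[\<alpha>^(n+1), \<alpha>^n[\<close>, so the preimage is obtained by shifting each such
  piece of \<open>A\<close> back. Measurability and measure then reduce to translation invariance
  and countable unions.\<close>

lemma kakutani_fibonacci_vimage:
  "kakutani_fibonacci -` A \<inter> {0..<1} =
     (\<Union>n. (+) (- kf_shift (Suc n)) ` (A \<inter> {kf_alpha ^ Suc n..<kf_alpha ^ n}))" (is "?L = ?R")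
proof -
  have width: "kf_alpha ^ Suc n + kf_alpha ^ Suc (Suc n) = kf_alpha ^ n" for n
    by (rule kf_alpha_power_add)
  have iff: "x \<in> kf_interval (Suc n) \<longleftrightarrow> x + kf_shift (Suc n) \<in> {kf_alpha ^ Suc n..<kf_alpha ^ n}" for x n
    unfolding width[of n, symmetric] by (auto simp: kf_interval_conv_start kf_shift_conv_start)
  show ?thesis
  proof (intro equalityI subsetI)
    fix x assume x: "x \<in> ?L"
    then have "x \<in> (\<Union>n\<in>{1..}. kf_interval n)"
      unfolding kf_interval_partition(1) by simp
    then obtain n where "1 \<le> n" "x \<in> kf_interval n" by auto
    then obtain m where m: "x \<in> kf_interval (Suc m)"
      by (cases n) auto
    then have "kakutani_fibonacci x = x + kf_shift (Suc m)"
      by (intro kakutani_fibonacci_on_interval) auto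
    with x m have "x + kf_shift (Suc m) \<in> A \<inter> {kf_alpha ^ Suc m..<kf_alpha ^ m}"
      by (simp add: iff)
    then have "x \<in> (+) (- kf_shift (Suc m)) ` (A \<inter> {kf_alpha ^ Suc m..<kf_alpha ^ m})"
      by (intro image_eqI[of _ _ "x + kf_shift (Suc m)"]) auto
    then show "x \<in> ?R" by blast
  next
    fix x assume "x \<in> ?R"
    then obtain n where "x \<in> (+) (- kf_shift (Suc n)) ` (A \<inter> {kf_alpha ^ Suc n..<kf_alpha ^ n})"
      by blast
    then have *: "x + kf_shift (Suc n) \<in> A" "x \<in> kf_interval (Suc n)"
      by (auto simp: iff)
    then show "x \<in> ?L"
      using kf_interval_subset[of "Suc n"] kakutani_fibonacci_on_interval[of "Suc n" x] by auto
  qed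
qed

lemma kf_image_partition:
  "(\<Union>n. {kf_alpha ^ Suc n..<kf_alpha ^ n}) = {0<..<1}"
  "disjoint_family (\<lambda>n. {kf_alpha ^ Suc n..<kf_alpha ^ n})"
proof -
  show "(\<Union>n. {kf_alpha ^ Suc n..<kf_alpha ^ n}) = {0<..<1}"
  proof (intro equalityI subsetI)
    fix x assume "x \<in> (\<Union>n. {kf_alpha ^ Suc n..<kf_alpha ^ n})"
    then obtain n where "kf_alpha ^ Suc n \<le> x" "x < kf_alpha ^ n" by auto
    then show "x \<in> {0<..<1}"
      using kf_alpha_power_pos[of "Suc n"] kf_alpha_power_le_1[of n] by simp
  next
    fix x :: real assume x: "x \<in> {0<..<1}"
    have "\<exists>n. kf_alpha ^ n \<le> x"
      using x real_arch_pow_inv[of x kf_alpha] kf_alpha_less_1 by (auto intro: less_imp_le)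
    then obtain n where n: "kf_alpha ^ n \<le> x" "\<And>m. m < n \<Longrightarrow> x < kf_alpha ^ m"
      using exists_least_iff[of "\<lambda>n. kf_alpha ^ n \<le> x"] by (auto simp: not_le)
    with x obtain m where "n = Suc m" by (cases n) auto
    with n show "x \<in> (\<Union>n. {kf_alpha ^ Suc n..<kf_alpha ^ n})" by auto
  qed
  have "{kf_alpha ^ Suc m..<kf_alpha ^ m} \<inter> {kf_alpha ^ Suc n..<kf_alpha ^ n} = {}" if "m < n" for m n
    using kf_alpha_power_antimono[of "Suc m" n] that by auto
  then show "disjoint_family (\<lambda>n. {kf_alpha ^ Suc n..<kf_alpha ^ n})"
    by (auto simp: disjoint_family_on_def neq_iff Int_commute)
qed

lemma kakutani_fibonacci_vimage_lebesgue:
  assumes "A \<in> sets lebesgue"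
  shows "kakutani_fibonacci -` A \<inter> {0..<1} \<in> sets lebesgue"
  unfolding kakutani_fibonacci_vimage
  by (intro sets.countable_UN image_subsetI lebesgue_sets_translation sets.Int assms) auto

lemma emeasure_kakutani_fibonacci_vimage:
  assumes A: "A \<in> sets lebesgue" "A \<subseteq> {0..<1}"
  shows "emeasure lebesgue (kakutani_fibonacci -` A \<inter> {0..<1}) = emeasure lebesgue A"
proof -
  let ?J = "\<lambda>n. {kf_alpha ^ Suc n..<kf_alpha ^ n}"
  let ?V = "\<lambda>n. (+) (- kf_shift (Suc n)) ` (A \<inter> ?J n)"
  \<comment> \<open>The shifted pieces inherit disjointness from the intervals
    \<open>I_(n+1)\<close> that contain them.\<close>
  have V_sub: "?V n \<subseteq> kf_interval (Suc n)" for n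
    using kf_alpha_power_add[of n] by (auto simp: kf_interval_conv_start kf_shift_conv_start)
  have disj: "disjoint_family ?V"
    unfolding disjoint_family_on_def
  proof (intro ballI impI)
    fix m n :: nat assume "m \<noteq> n"
    then have "kf_interval (Suc m) \<inter> kf_interval (Suc n) = {}"
      using kf_interval_partition(2) by (auto simp: disjoint_family_on_def)
    then show "?V m \<inter> ?V n = {}"
      using V_sub[of m] V_sub[of n] by blast
  qed
  have V_sets: "range ?V \<subseteq> sets lebesgue"
    by (intro image_subsetI lebesgue_sets_translation sets.Int A) auto
  have "emeasure lebesgue (kakutani_fibonacci -` A \<inter> {0..<1}) = (\<Sum>n. emeasure lebesgue (?V n))"
    unfolding kakutani_fibonacci_vimage using suminf_emeasure[OF V_sets disj] by simp
  also have "\<dots> = (\<Sum>n. emeasure lebesgue (A \<inter> ?J n))"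
    by (simp only: emeasure_lebesgue_translation)
  also have "\<dots> = emeasure lebesgue (\<Union>n. A \<inter> ?J n)"
    by (intro suminf_emeasure image_subsetI sets.Int A
        disjoint_family_subset[OF kf_image_partition(2)]) auto
  \<comment> \<open>0 is the only point of \<open>[0,1[\<close> outside the range of
    \<open>T\<close>, and a single point is a null set.\<close>
  also have "(\<Union>n. A \<inter> ?J n) = A - {0}"
    using kf_image_partition(1) A(2) by (auto simp flip: Int_UN_distrib)
  also have "emeasure lebesgue (A - {0}) = emeasure lebesgue A"
    using A(1) by (intro emeasure_Diff_null_set) auto
  finally show ?thesis .
qed

lemma measure_preserving_kakutani_fibonacci:
  "measure_preserving_map (lebesgue_on {0..<1}) kakutani_fibonacci"
  unfolding measure_preserving_map_def
proof (intro conjI ballI measurableI)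
  fix x :: real assume "x \<in> space (lebesgue_on {0..<1})"
  then show "kakutani_fibonacci x \<in> space (lebesgue_on {0..<1})"
    using kakutani_fibonacci_range by simp
next
  fix A assume "A \<in> sets (lebesgue_on {0..<1::real})"
  then have A: "A \<in> sets lebesgue" "A \<subseteq> {0..<1}"
    by (auto simp: sets_restrict_space_iff)
  show "kakutani_fibonacci -` A \<inter> space (lebesgue_on {0..<1}) \<in> sets (lebesgue_on {0..<1})"
    using kakutani_fibonacci_vimage_lebesgue[OF A(1)] by (auto simp: sets_restrict_space_iff)
  show "emeasure (lebesgue_on {0..<1}) (kakutani_fibonacci -` A \<inter> space (lebesgue_on {0..<1}))
      = emeasure (lebesgue_on {0..<1}) A"
    using emeasure_kakutani_fibonacci_vimage[OF A] A by (simp add: emeasure_restrict_space)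
qed

section \<open>Cylinders\<close>

text \<open>For \<open>n \<ge> 1\<close> the base interval \<open>[0, \<alpha>^n[\<close> is carried by an iterate of \<open>T\<close> onto an interval
  starting with \<open>I_n\<close>; one more application leads to \<open>[\<alpha>^n, \<alpha>^n + \<alpha>^(n+1)[\<close>, which
  feeds the induction for the next indices.\<close>

lemma kakutani_fibonacci_reaches_power_aux:
  assumes "1 \<le> n" "\<forall>x\<in>{0..<kf_alpha ^ n}. (kakutani_fibonacci ^^ k) x = x + kf_start n"
  shows "\<forall>x\<in>{0..<kf_alpha ^ Suc n}. (kakutani_fibonacci ^^ Suc k) x = x + kf_alpha ^ n"
proof
  fix x assume x: "x \<in> {0..<kf_alpha ^ Suc n}"
  then have "x \<in> {0..<kf_alpha ^ n}"
    using kf_alpha_power_antimono[of n "Suc n"] by auto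
  with assms x show "(kakutani_fibonacci ^^ Suc k) x = x + kf_alpha ^ n"
    using kakutani_fibonacci_on_start by simp
qed

lemma kakutani_fibonacci_reaches_start:
  "\<exists>k. \<forall>x\<in>{0..<kf_alpha ^ n}. (kakutani_fibonacci ^^ k) x = x + kf_start n"
proof (induction n rule: less_induct)
  case (less n)
  consider "n = 0" | "n = 1" | m where "n = Suc (Suc m)"
    by (metis One_nat_def not0_implies_Suc)
  then show ?case
  proof cases
    \<comment> \<open>The first \<open>Suc i\<close> steps lift \<open>[0, \<alpha>^n[\<close> to
      \<open>[\<alpha>^(m+1), \<alpha>^m[\<close>, which still lies in
      \<open>[0, \<alpha>^m[\<close>. So \<open>j\<close> further steps add
      \<open>kf_start m\<close>, and the two shifts sum to \<open>kf_start n\<close>.\<close>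
    case 3
    obtain j where j: "\<forall>x\<in>{0..<kf_alpha ^ m}. (kakutani_fibonacci ^^ j) x = x + kf_start m"
      using less[of m] 3 by auto
    obtain i where "\<forall>x\<in>{0..<kf_alpha ^ Suc m}. (kakutani_fibonacci ^^ i) x = x + kf_start (Suc m)"
      using less[of "Suc m"] 3 by auto
    from kakutani_fibonacci_reaches_power_aux[OF _ this]
    have i: "\<forall>x\<in>{0..<kf_alpha ^ n}. (kakutani_fibonacci ^^ Suc i) x = x + kf_alpha ^ Suc m"
      using 3 by simp
    have "(kakutani_fibonacci ^^ (j + Suc i)) x = x + kf_start n" if x: "x \<in> {0..<kf_alpha ^ n}" for x
    proof -
      have "x + kf_alpha ^ Suc m \<in> {0..<kf_alpha ^ m}"
        using x 3 kf_alpha_power_add[of m] kf_alpha_power_pos[of "Suc m"] by auto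
      with j have "(kakutani_fibonacci ^^ j) (x + kf_alpha ^ Suc m) = x + kf_alpha ^ Suc m + kf_start m"
        by blast
      then show ?thesis
        unfolding funpow_add comp_apply bspec[OF i x] by (simp add: 3 kf_start_Suc_Suc)
    qed
    then show ?thesis by blast
  qed (auto simp: kf_start_def intro: exI[of _ 0])
qed

lemma kakutani_fibonacci_reaches_power:
  assumes "1 \<le> n"
  obtains k where "\<forall>x\<in>{0..<kf_alpha ^ Suc n}. (kakutani_fibonacci ^^ k) x = x + kf_alpha ^ n"
  using kakutani_fibonacci_reaches_start[of n] kakutani_fibonacci_reaches_power_aux[OF assms] by blast

text \<open>\<open>kf_cylinder u n\<close> stands for the interval \<open>[u, u + \<alpha>^n[\<close>.\<close>

inductive kf_cylinder :: "real \<Rightarrow> nat \<Rightarrow> bool" where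
  base: "kf_cylinder 0 0"
| left: "kf_cylinder u n \<Longrightarrow> kf_cylinder u (Suc n)"
| right: "kf_cylinder u n \<Longrightarrow> kf_cylinder (u + kf_alpha ^ Suc n) (Suc (Suc n))"

lemma kf_cylinder_bounds: "kf_cylinder u n \<Longrightarrow> 0 \<le> u \<and> u + kf_alpha ^ n \<le> 1"
proof (induction rule: kf_cylinder.induct)
  case (left u n)
  then show ?case using kf_alpha_power_antimono[of n "Suc n"] by simp
next
  case (right u n)
  then show ?case using kf_alpha_power_add[of n] kf_alpha_power_pos[of "Suc n"] by simp
qed simp

text \<open>Splitting the cylinder around \<open>t\<close> leaves \<open>t\<close> in a part whose
  index is larger by 1 or 2, so the index can be made arbitrarily large.\<close>

lemma kf_cylinder_exists:
  assumes "t \<in> {0..<1}"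
  shows "\<exists>u n. N \<le> n \<and> kf_cylinder u n \<and> t \<in> {u..<u + kf_alpha ^ n}"
proof (induction N)
  case 0
  then show ?case using assms kf_cylinder.base by fastforce
next
  case (Suc N)
  then obtain u n where u: "N \<le> n" "kf_cylinder u n" "t \<in> {u..<u + kf_alpha ^ n}" by blast
  show ?case
  proof (cases "t < u + kf_alpha ^ Suc n")
    case True
    with u show ?thesis
      by (intro exI[of _ u] exI[of _ "Suc n"]) (auto intro: kf_cylinder.left)
  next
    case False
    with u kf_alpha_power_add[of n] show ?thesis
      by (intro exI[of _ "u + kf_alpha ^ Suc n"] exI[of _ "Suc (Suc n)"])
        (use kf_cylinder.right[OF u(2)] in auto)
  qed
qed

text \<open>For a right part, \<open>[0, \<alpha>^(n+2)[\<close> is first moved onto the upper part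
  of \<open>[0, \<alpha>^n[\<close>; the iterate that belongs to the parent cylinder then carries it
  on by \<open>u\<close>.\<close>

lemma kf_cylinder_reachable:
  "kf_cylinder u n \<Longrightarrow> \<exists>k. \<forall>x\<in>{0..<kf_alpha ^ n}. (kakutani_fibonacci ^^ k) x = x + u"
proof (induction rule: kf_cylinder.induct)
  case base
  show ?case by (intro exI[of _ 0]) simp
next
  case (left u n)
  moreover have "{0..<kf_alpha ^ Suc n} \<subseteq> {0..<kf_alpha ^ n}"
    using kf_alpha_power_antimono[of n "Suc n"] by auto
  ultimately show ?case by blast
next
  case (right u n)
  then obtain k where k: "\<forall>x\<in>{0..<kf_alpha ^ n}. (kakutani_fibonacci ^^ k) x = x + u" by blast
  obtain j where j: "\<forall>x\<in>{0..<kf_alpha ^ Suc (Suc n)}. (kakutani_fibonacci ^^ j) x = x + kf_alpha ^ Suc n"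
    by (rule kakutani_fibonacci_reaches_power[of "Suc n"]) auto
  have "(kakutani_fibonacci ^^ (k + j)) x = x + (u + kf_alpha ^ Suc n)"
    if x: "x \<in> {0..<kf_alpha ^ Suc (Suc n)}" for x
  proof -
    have "x + kf_alpha ^ Suc n \<in> {0..<kf_alpha ^ n}"
      using x kf_alpha_power_add[of n] kf_alpha_power_pos[of "Suc n"] by auto
    with k have "(kakutani_fibonacci ^^ k) (x + kf_alpha ^ Suc n) = x + kf_alpha ^ Suc n + u"
      by blast
    then show ?thesis
      unfolding funpow_add comp_apply bspec[OF j x] by simp
  qed
  then show ?case by blast
qed

section \<open>Invariant sets\<close>

text \<open>The other characteristic root of the recurrence has modulus greater than 1.\<close>

lemma bounded_fibonacci_recurrence:
  fixes m :: "nat \<Rightarrow> real"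
  assumes rec: "\<And>n. m n = m (Suc n) + m (Suc (Suc n))" and bounded: "\<And>n. \<bar>m n\<bar> \<le> B"
  shows "m n = m 0 * kf_alpha ^ n"
proof -
  \<comment> \<open>This removes the component with root \<open>\<alpha>\<close>. What remains is
    multiplied by \<open>-1/\<alpha>\<close> at each step, so boundedness forces it to
    vanish.\<close>
  define d where "d n = m (Suc n) - kf_alpha * m n" for n
  have "kf_alpha * (1 + kf_alpha) = 1"
    using kf_alpha_eq by (simp add: power2_eq_square algebra_simps)
  then have d_rec: "d n = - (kf_alpha * d (Suc n))" for n
    using rec[of n] unfolding d_def by algebra
  have d_abs: "\<bar>d k\<bar> = kf_alpha ^ n * \<bar>d (k + n)\<bar>" for k n
  proof (induction n)
    case (Suc n)
    then show ?case
      using d_rec[of "k + n"] kf_alpha_pos by (simp add: abs_mult)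
  qed simp
  have "\<bar>kf_alpha * m n\<bar> \<le> 1 * B" for n
    unfolding abs_mult using bounded[of n] kf_alpha_pos kf_alpha_less_1
    by (intro mult_mono) auto
  then have d_bounded: "\<bar>d n\<bar> \<le> 2 * B" for n
    using bounded[of "Suc n"] abs_triangle_ineq4[of "m (Suc n)" "kf_alpha * m n"]
    unfolding d_def by (smt (verit))
  have d_zero: "d k = 0" for k
  proof -
    have "\<bar>d k\<bar> \<le> kf_alpha ^ n * (2 * B)" for n
      unfolding d_abs[of k n] using kf_alpha_power_pos[of n] d_bounded
      by (intro mult_left_mono) auto
    moreover have "(\<lambda>n. kf_alpha ^ n * (2 * B)) \<longlonglongrightarrow> 0 * (2 * B)"
      using kf_alpha_pos kf_alpha_less_1 by (intro tendsto_mult LIMSEQ_power_zero tendsto_const) auto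
    ultimately have "\<bar>d k\<bar> \<le> 0 * (2 * B)"
      by (intro LIMSEQ_le_const) auto
    then show ?thesis by simp
  qed
  show ?thesis
  proof (induction n)
    case (Suc n)
    then show ?case using d_zero[of n] by (simp add: d_def algebra_simps)
  qed simp
qed

section \<open>Density of an invariant set in intervals and in Borel sets\<close>

locale kf_invariant =
  fixes A :: "real set"
  assumes lebesgue: "A \<in> sets lebesgue"
    and invariant: "kakutani_fibonacci -` A \<inter> {0..<1} = A"
begin

abbreviation "\<mu> \<equiv> measure lebesgue"

lemma subset: "A \<subseteq> {0..<1}"
  using invariant by blast

lemma lmeasurable: "A \<in> lmeasurable"
  using lebesgue subset by (intro bounded_set_imp_lmeasurable bounded_subset[OF _ subset]) auto

lemma lmeasurable_Int: "S \<in> sets lebesgue \<Longrightarrow> A \<inter> S \<in> lmeasurable"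
  using lmeasurable by (intro fmeasurable_Int_fmeasurable)

text \<open>The range is carried through the induction because invariance relates \<open>x\<close>
  and \<open>T x\<close> only for \<open>x\<close> in \<open>[0,1[\<close>.\<close>

lemma funpow_mem_iff:
  assumes "x \<in> {0..<1}"
  shows "(kakutani_fibonacci ^^ k) x \<in> {0..<1} \<and> ((kakutani_fibonacci ^^ k) x \<in> A \<longleftrightarrow> x \<in> A)"
proof (induction k)
  case (Suc k)
  then show ?case
    using kakutani_fibonacci_range invariant by auto
qed (use assms in simp)

text \<open>By invariance, an iterate that translates \<open>[0, w[\<close> by \<open>u\<close>
  matches the points of \<open>A\<close> in both intervals, and Lebesgue measure is translation
  invariant.\<close>

lemma measure_Int_reachable:
  assumes "\<forall>x\<in>{0..<w}. (kakutani_fibonacci ^^ k) x = x + u" and "w \<le> 1"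
  shows "\<mu> (A \<inter> {u..<u + w}) = \<mu> (A \<inter> {0..<w})"
proof -
  have "u + x \<in> A \<longleftrightarrow> x \<in> A" if "x \<in> {0..<w}" for x
    using funpow_mem_iff[of x k] assms that by (auto simp: add.commute)
  from this[of "y - u" for y] have "y \<in> A \<longleftrightarrow> y - u \<in> A" if "y \<in> {u..<u + w}" for y
    using that by auto
  then have "A \<inter> {u..<u + w} = (\<lambda>y. y - u) -` (A \<inter> {0..<w})"
    by auto
  also have "\<dots> = (+) u ` (A \<inter> {0..<w})"
    by (force simp: image_iff)
  finally have "A \<inter> {u..<u + w} = (+) u ` (A \<inter> {0..<w})" .
  then show ?thesis by (simp add: measure_translation)
qed

lemma measure_Int_split:
  assumes "a \<le> b" "b \<le> c"
  shows "\<mu> (A \<inter> {a..<c}) = \<mu> (A \<inter> {a..<b}) + \<mu> (A \<inter> {b..<c})"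
proof -
  have "A \<inter> {a..<c} = (A \<inter> {a..<b}) \<union> (A \<inter> {b..<c})"
    using assms by auto
  moreover have "(A \<inter> {a..<b}) \<inter> (A \<inter> {b..<c}) = {}"
    by auto
  ultimately show ?thesis
    using measure_Un3[of "A \<inter> {a..<b}" lebesgue "A \<inter> {b..<c}"] by (simp add: lmeasurable_Int)
qed

lemma measure_Int_le:
  assumes "a \<le> b"
  shows "\<mu> (A \<inter> {a..<b}) \<le> b - a"
proof -
  have "\<mu> (A \<inter> {a..<b}) \<le> \<mu> {a..<b}"
    using lebesgue by (intro measure_mono_fmeasurable bounded_set_imp_lmeasurable) auto
  with assms show ?thesis by simp
qed

lemma measure_Int_base: "\<mu> (A \<inter> {0..<kf_alpha ^ n}) = \<mu> A * kf_alpha ^ n"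
proof -
  define m where "m n = \<mu> (A \<inter> {0..<kf_alpha ^ n})" for n
  have "m n = m (Suc n) + m (Suc (Suc n))" for n
  proof -
    \<comment> \<open>The upper part of \<open>[0, \<alpha>^n[\<close> is a translate of
      \<open>[0, \<alpha>^(n+2)[\<close> by an iterate; this gives the second term of the
      recurrence.\<close>
    obtain k where
      "\<forall>x\<in>{0..<kf_alpha ^ Suc (Suc n)}. (kakutani_fibonacci ^^ k) x = x + kf_alpha ^ Suc n"
      by (rule kakutani_fibonacci_reaches_power[of "Suc n"]) auto
    from measure_Int_reachable[OF this kf_alpha_power_le_1]
    have "\<mu> (A \<inter> {kf_alpha ^ Suc n..<kf_alpha ^ n}) = m (Suc (Suc n))"
      unfolding m_def kf_alpha_power_add .
    then show ?thesis
      using measure_Int_split[of 0 "kf_alpha ^ Suc n" "kf_alpha ^ n"]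
        kf_alpha_power_pos[of "Suc n"] kf_alpha_power_antimono[of n "Suc n"]
      by (simp add: m_def)
  qed
  moreover have "\<bar>m n\<bar> \<le> 1" for n
    using measure_Int_le[of 0 "kf_alpha ^ n"] kf_alpha_power_pos[of n] kf_alpha_power_le_1[of n]
    by (simp add: m_def)
  ultimately have "m n = m 0 * kf_alpha ^ n"
    by (rule bounded_fibonacci_recurrence)
  moreover have "A \<inter> {0..<1} = A"
    using subset by blast
  ultimately show ?thesis by (simp add: m_def)
qed

lemma measure_Int_cylinder:
  assumes "kf_cylinder u n"
  shows "\<mu> (A \<inter> {u..<u + kf_alpha ^ n}) = \<mu> A * kf_alpha ^ n"
proof -
  obtain k where "\<forall>x\<in>{0..<kf_alpha ^ n}. (kakutani_fibonacci ^^ k) x = x + u"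
    using kf_cylinder_reachable[OF assms] by blast
  from measure_Int_reachable[OF this kf_alpha_power_le_1] show ?thesis
    by (simp only: measure_Int_base)
qed

text \<open>Each \<open>right\<close> step moves the left end across the left sibling, which is
  itself a cylinder and so has the correct density.\<close>

lemma measure_Int_cylinder_start:
  "kf_cylinder u n \<Longrightarrow> \<mu> (A \<inter> {0..<u}) = \<mu> A * u"
proof (induction rule: kf_cylinder.induct)
  case (right u n)
  have "\<mu> (A \<inter> {u..<u + kf_alpha ^ Suc n}) = \<mu> A * kf_alpha ^ Suc n"
    using right(1) by (intro measure_Int_cylinder kf_cylinder.left)
  then show ?case
    using right kf_cylinder_bounds[OF right(1)] kf_alpha_power_pos[of "Suc n"]
      measure_Int_split[of 0 u "u + kf_alpha ^ Suc n"]
    by (simp add: algebra_simps)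
qed auto

text \<open>The density is exact up to the left end \<open>u\<close> of a cylinder around
  \<open>t\<close>. On \<open>[u, t[\<close> both quantities lie between 0 and
  \<open>t - u \<le> \<alpha>^N\<close>, and \<open>N\<close> is arbitrary.\<close>

lemma measure_Int_initial:
  assumes "t \<in> {0..<1}"
  shows "\<mu> (A \<inter> {0..<t}) = \<mu> A * t"
proof -
  have \<mu>_le: "\<mu> A \<le> 1"
    using measure_Int_le[of 0 1] subset by (simp add: inf.absorb1)
  have close: "\<bar>\<mu> (A \<inter> {0..<t}) - \<mu> A * t\<bar> \<le> kf_alpha ^ N" for N
  proof -
    obtain u n where u: "N \<le> n" "kf_cylinder u n" "t \<in> {u..<u + kf_alpha ^ n}"
      using kf_cylinder_exists[OF assms] by blast
    have "\<mu> (A \<inter> {0..<t}) = \<mu> A * u + \<mu> (A \<inter> {u..<t})"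
      using measure_Int_split[of 0 u t] measure_Int_cylinder_start[OF u(2)]
        kf_cylinder_bounds[OF u(2)] u(3) by simp
    then have "\<mu> (A \<inter> {0..<t}) - \<mu> A * t = \<mu> (A \<inter> {u..<t}) - \<mu> A * (t - u)"
      by (simp add: algebra_simps)
    moreover have "0 \<le> \<mu> (A \<inter> {u..<t})" "\<mu> (A \<inter> {u..<t}) \<le> t - u"
      using measure_Int_le[of u t] u(3) by auto
    moreover have "0 \<le> \<mu> A * (t - u)" "\<mu> A * (t - u) \<le> t - u"
      using \<mu>_le u(3) by (auto intro: mult_left_le_one_le)
    ultimately have "\<bar>\<mu> (A \<inter> {0..<t}) - \<mu> A * t\<bar> \<le> t - u"
      by linarith
    also have "\<dots> \<le> kf_alpha ^ N"
      using u(3) kf_alpha_power_antimono[OF u(1)] by simp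
    finally show ?thesis .
  qed
  have "(\<lambda>N. kf_alpha ^ N) \<longlonglongrightarrow> 0"
    using kf_alpha_pos kf_alpha_less_1 by (intro LIMSEQ_power_zero) auto
  then have "\<bar>\<mu> (A \<inter> {0..<t}) - \<mu> A * t\<bar> \<le> 0"
    by (rule LIMSEQ_le_const) (use close in auto)
  then show ?thesis by simp
qed

text \<open>Open rays determine a finite Borel measure, so the density of initial segments is
  restated for rays.\<close>

lemma measure_Int_Ioi: "\<mu> (A \<inter> {x<..}) = \<mu> A * measure lborel ({0..<1} \<inter> {x<..})"
proof -
  consider "x < 0" | "0 \<le> x" "x < 1" | "1 \<le> x" by linarith
  then show ?thesis
  proof cases
    case 1
    then have "A \<inter> {x<..} = A" "{0..<1} \<inter> {x<..} = {0..<1}"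
      using subset by auto
    then show ?thesis by simp
  next
    case 2
    have "\<mu> A = \<mu> (A \<inter> {0..<1})"
      using subset by (simp add: inf.absorb1)
    also have "\<dots> = \<mu> A * x + \<mu> (A \<inter> {x..<1})"
      using measure_Int_split[of 0 x 1] measure_Int_initial[of x] 2 by simp
    also have "\<mu> (A \<inter> {x..<1}) = \<mu> (A \<inter> {x..<1} - {x})"
      using lebesgue by (intro measure_Diff_null_set[symmetric]) auto
    also have "A \<inter> {x..<1} - {x} = A \<inter> {x<..}"
      using subset by auto
    finally have "\<mu> (A \<inter> {x<..}) = \<mu> A * (1 - x)"
      by (simp add: algebra_simps)
    moreover have "{0..<1} \<inter> {x<..} = {x<..<1}"
      using 2 by auto
    ultimately show ?thesis using 2 by simp
  next
    case 3
    then have "A \<inter> {x<..} = {}" "{0..<1} \<inter> {x<..} = {}"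
      using subset by auto
    then show ?thesis by (simp only: measure_empty mult_zero_right)
  qed
qed

text \<open>Lebesgue measure restricted to \<open>A\<close> and \<open>\<mu> A\<close> times
  Lebesgue measure on \<open>[0,1[\<close> agree on rays, hence on all Borel sets. Evaluating both
  at (almost all of) \<open>A\<close> itself gives
  \<open>\<mu> A = \<mu> A * \<mu> A\<close>.\<close>

lemma measure_0_or_1: "\<mu> A = 0 \<or> \<mu> A = 1"
proof -
  \<comment> \<open>The comparison takes place on Borel sets, while \<open>A\<close> is only
    Lebesgue measurable; the Borel set \<open>S\<close> replaces it up to a null set.\<close>
  obtain S N N' where S: "A = S \<union> N" "N \<subseteq> N'" "N' \<in> null_sets lborel" "S \<in> sets lborel"
    using sets_completionE[OF lebesgue] .
  have N: "N \<in> null_sets lebesgue"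
    using S by (intro null_sets_completion_subset[of N N']) (auto intro: null_sets_completionI)
  have S_Int: "emeasure lborel (S \<inter> B) = ennreal (\<mu> (A \<inter> B))" if "B \<in> sets borel" for B
  proof -
    have "emeasure lborel (S \<inter> B) = emeasure lebesgue (S \<inter> B)"
      using S that by simp
    also have "\<dots> = emeasure lebesgue ((S \<inter> B) \<union> (N \<inter> B))"
      using S N that by (intro emeasure_Un_null_set[symmetric] null_set_Int2) auto
    also have "(S \<inter> B) \<union> (N \<inter> B) = A \<inter> B"
      using S by blast
    also have "emeasure lebesgue (A \<inter> B) = ennreal (\<mu> (A \<inter> B))"
      using that by (intro emeasure_eq_measure2 lmeasurable_Int) auto
    finally show ?thesis .
  qed
  define M where "M = density lborel (indicator S)"
  define M' where "M' = scale_measure (ennreal (\<mu> A)) (density lborel (indicator {0..<1::real}))"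
  have M: "emeasure M B = ennreal (\<mu> (A \<inter> B))" if "B \<in> sets borel" for B
  proof -
    have "emeasure M B = emeasure lborel (S \<inter> B)"
      unfolding M_def using S that by (intro emeasure_restricted) auto
    with S_Int[OF that] show ?thesis by simp
  qed
  have M': "emeasure M' B = ennreal (\<mu> A * measure lborel ({0..<1} \<inter> B))" if "B \<in> sets borel" for B
  proof -
    have "emeasure M' B = ennreal (\<mu> A) * emeasure lborel ({0..<1} \<inter> B)"
      unfolding M'_def emeasure_scale_measure using that by (subst emeasure_restricted) auto
    also have "emeasure lborel ({0..<1} \<inter> B) = ennreal (measure lborel ({0..<1} \<inter> B))"
      using that by (intro emeasure_eq_measure2 fmeasurable_Int_fmeasurable)
        (auto simp: fmeasurable_def)
    finally show ?thesis by (simp add: ennreal_mult)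
  qed
  have "M = M'"
  proof (rule measure_eqI_lessThan)
    show "sets M = sets borel" "sets M' = sets borel"
      by (simp_all add: M_def M'_def)
  qed (simp_all add: M M' measure_Int_Ioi)
  \<comment> \<open>Since \<open>S\<close> lies in \<open>A\<close> and in \<open>[0,1[\<close> and
    has measure \<open>\<mu> A\<close>, the two sides are \<open>\<mu> A\<close> and its
    square.\<close>
  then have "emeasure M S = emeasure M' S" by simp
  moreover have "\<mu> (A \<inter> S) = \<mu> A" "measure lborel ({0..<1} \<inter> S) = \<mu> A"
  proof -
    have "\<mu> (S \<union> N) = \<mu> S"
      using S N by (intro measure_Un_null_set) auto
    moreover have "A \<inter> S = S" "{0..<1} \<inter> S = S"
      using S(1) subset by auto
    ultimately show "\<mu> (A \<inter> S) = \<mu> A" "measure lborel ({0..<1} \<inter> S) = \<mu> A"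
      using S by auto
  qed
  ultimately have "\<mu> A = \<mu> A * \<mu> A"
    using S M M' by simp
  then show ?thesis by auto
qed

end

theorem theorem3p1p4:
  shows "ergodic_map (lebesgue_on {0..<1}) kakutani_fibonacci"
  unfolding ergodic_map_def
proof (intro conjI ballI impI measure_preserving_kakutani_fibonacci)
  show "prob_space (lebesgue_on {0..<1::real})"
    by (intro prob_spaceI) (simp add: emeasure_restrict_space)
next
  fix A assume "A \<in> sets (lebesgue_on {0..<1::real})"
    and inv: "kakutani_fibonacci -` A \<inter> space (lebesgue_on {0..<1}) = A"
  then have A: "A \<in> sets lebesgue" "A \<subseteq> {0..<1}"
    by (auto simp: sets_restrict_space_iff)
  interpret kf_invariant A
    using A inv by unfold_locales auto
  show "measure (lebesgue_on {0..<1}) A = 0 \<or> measure (lebesgue_on {0..<1}) A = 1"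
    using measure_0_or_1 A by (simp add: measure_restrict_space)
qed

end
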